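(* The element $$\Omega =x_1A+x_2B+x_3A^2+x_4\{A,B\}+x_5 B^2+x_6A^3+x_7 ABA+x_8 BC-x_{8}AB^2+x_{9} A^4+x_{10} B^3+C^2$$ of $\mathcal{A}^{gen}$, where $$x_1= \tfrac{1}{6}( 12 a_9 +3 a_0 a_5 a'_0 + 2 a_4 a_3- a_4 a'_0 a_1 - 6 a_6 a_1),$$ $$x_2= \tfrac{1}{3}(- 6 a_8-3 a_4 a_2 + a_0 a_4 a'_0 + a_0 a_6 + 6 a_5 a_1),$$ $$x_3= \tfrac{1}{6}( 6 a_6 +3 a_4 a'_0 + 3 a_0 a_2 a'_0 - 4 a_3 a_1 - a'_0 a_1^2),$$ $$x_4=\tfrac{1}{3}(-3a_5+a_0a_3+3a_2a_1+a_0a'_0a_1),$$ $$x_5= \tfrac{1}{3}(-3 a_4 - 4 a_0 a_2 + a_0^2 a'_0 + 6 a_1^2),$$ $$x_6= \tfrac{1}{3}(2 a_3 - a'_0 a_1),\quad x_7= -2 a_2 + a_0 a'_0,\quad x_8 = 2 a_1,\quad x_{9} =\tfrac{1}{2}a'_0,\quad x_{10}= -\tfrac{2}{3}a_0,$$ is central in $\mathcal{A}^{gen}$. It has degree $12$, and this is the minimal degree of a non-scalar central element of $\mathcal{A}^{gen}$ (i.e. of a central element not lying in $\mathbb{C}[\mathcal{P}]$).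
   Context: Let $\mathcal{P}=\{a_0,a'_0,a_1,a_2,a_3,a_4,a_5,a_6,a_8,a_9\}$ be a set of indeterminates and $\mathbb{C}[\mathcal{P}]$ the commutative polynomial algebra in them. The algebra $\mathcal{A}^{gen}$ is the associative unital algebra over $\mathbb{C}[\mathcal{P}]$ generated by $A,B,C$ with defining relations $$[A,B]=C,$$ $$[A,C]=a_0B^2+a_1\{A,B\}+a_2A^2+a_4B+a_5A+a_8,$$ $$[B,C]=a'_0A^3-a_1B^2-a_2\{A,B\}+a_3A^2-a_5B+a_6A+a_9,$$ where $[x,y]=xy-yx$ and $\{x,y\}=xy+yx$. It is filtered by $\deg(A)=3$, $\deg(B)=4$, $\deg(C)=6$, with elements of $\mathbb{C}[\mathcal{P}]$ of degree $0$ (the $n$-th filtered piece is the $\mathbb{C}[\mathcal{P}]$-span of words in the generators of total degree at most $n$); the degree of an element is the smallest $n$ such that it lies in the $n$-th piece. *)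

theory Defs
  imports Complex_Main "HOL-Library.Poly_Mapping"
begin

subsection \<open>The coefficient ring\<close>

text \<open>\<^verbatim>\<open>P0'\<close> is the index of the indeterminate $a'_0$. There is no index 7.\<close>

datatype param = P0 | P0' | P1 | P2 | P3 | P4 | P5 | P6 | P8 | P9

type_synonym cpoly = "(param \<Rightarrow>\<^sub>0 nat) \<Rightarrow>\<^sub>0 complex"

definition const :: "complex \<Rightarrow> cpoly"
  where "const c = Poly_Mapping.single 0 c"

definition indet :: "param \<Rightarrow> cpoly"
  where "indet p = Poly_Mapping.single (Poly_Mapping.single p 1) 1"

abbreviation "a0 \<equiv> indet P0"
abbreviation "a0' \<equiv> indet P0'"
abbreviation "a1 \<equiv> indet P1"
abbreviation "a2 \<equiv> indet P2"
abbreviation "a3 \<equiv> indet P3"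
abbreviation "a4 \<equiv> indet P4"
abbreviation "a5 \<equiv> indet P5"
abbreviation "a6 \<equiv> indet P6"
abbreviation "a8 \<equiv> indet P8"
abbreviation "a9 \<equiv> indet P9"

subsection \<open>The free algebra on three generators\<close>

datatype gen = GA | GB | GC

text \<open>The free monoid is written additively because the convolution product of
  \<^verbatim>\<open>Poly_Mapping\<close> adds exponents; the addition is not commutative.\<close>

datatype word = Word (letters: "gen list")

instantiation word :: monoid_add
begin

definition zero_word :: word where "0 = Word []"

definition plus_word :: "word \<Rightarrow> word \<Rightarrow> word"
  where "v + w = Word (letters v @ letters w)"

instance
  by standard (simp_all add: zero_word_def plus_word_def)

end

type_synonym falg = "word \<Rightarrow>\<^sub>0 cpoly"

definition fscalar :: "cpoly \<Rightarrow> falg"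
  where "fscalar p = Poly_Mapping.single 0 p"

definition fgen :: "gen \<Rightarrow> falg"
  where "fgen g = Poly_Mapping.single (Word [g]) 1"

lemma fscalar_0 [simp]: "fscalar 0 = 0"
  by (simp add: fscalar_def)

lemma fscalar_1 [simp]: "fscalar 1 = 1"
  by (simp add: fscalar_def)

lemma fscalar_add: "fscalar (p + q) = fscalar p + fscalar q"
  by (simp add: fscalar_def single_add)

lemma fscalar_mult: "fscalar (p * q) = fscalar p * fscalar q"
  by (simp add: fscalar_def mult_single)

lemma poly_mapping_monomial_induct [case_names zero add]:
  assumes "P 0" and "\<And>a b f. P f \<Longrightarrow> P (Poly_Mapping.single a b + f)"
  shows "P (f :: 'a \<Rightarrow>\<^sub>0 'b::comm_monoid_add)"
proof (induction f rule: update_induct)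
  case const
  show ?case by (rule assms)
next
  case (update f a b)
  then have "Poly_Mapping.update a b f = Poly_Mapping.single a b + f"
    by (intro poly_mapping_eqI)
      (auto simp: lookup_update lookup_add lookup_single when_def in_keys_iff)
  then show ?case using assms(2) update by simp
qed

lemma fscalar_commute: "fscalar p * x = x * fscalar p"
proof (induction x rule: poly_mapping_monomial_induct)
  case zero
  show ?case by simp
next
  case (add w q f)
  have "fscalar p * Poly_Mapping.single w q = Poly_Mapping.single w q * fscalar p"
    by (simp add: fscalar_def mult_single mult.commute)
  with add show ?case by (simp add: distrib_left distrib_right)
qed

subsection \<open>The algebra defined by the relations\<close>

definition commutator :: "'a::ring \<Rightarrow> 'a \<Rightarrow> 'a"
  where "commutator x y = x * y - y * x"

definition anticommutator :: "'a::ring \<Rightarrow> 'a \<Rightarrow> 'a"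
  where "anticommutator x y = x * y + y * x"

definition relators :: "falg set" where
  "relators =
    (let A = fgen GA; B = fgen GB; C = fgen GC in
      {commutator A B - C,
       commutator A C -
         (fscalar a0 * B^2 + fscalar a1 * anticommutator A B + fscalar a2 * A^2
          + fscalar a4 * B + fscalar a5 * A + fscalar a8),
       commutator B C -
         (fscalar a0' * A^3 - fscalar a1 * B^2 - fscalar a2 * anticommutator A B
          + fscalar a3 * A^2 - fscalar a5 * B + fscalar a6 * A + fscalar a9)})"

inductive_set twosided_ideal :: "'a::ring_1 set \<Rightarrow> 'a set" for R where
  zero: "0 \<in> twosided_ideal R"
| gen: "r \<in> R \<Longrightarrow> x * r * y \<in> twosided_ideal R"
| add: "u \<in> twosided_ideal R \<Longrightarrow> v \<in> twosided_ideal R \<Longrightarrow> u + v \<in> twosided_ideal R"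

lemma twosided_ideal_mult_left: "u \<in> twosided_ideal R \<Longrightarrow> z * u \<in> twosided_ideal R"
proof (induction rule: twosided_ideal.induct)
  case (gen r x y)
  then show ?case
    using twosided_ideal.gen[of r R "z * x" y] by (simp add: mult.assoc)
qed (auto simp: distrib_left intro: twosided_ideal.intros)

lemma twosided_ideal_mult_right: "u \<in> twosided_ideal R \<Longrightarrow> u * z \<in> twosided_ideal R"
proof (induction rule: twosided_ideal.induct)
  case (gen r x y)
  then show ?case
    using twosided_ideal.gen[of r R x "y * z"] by (simp add: mult.assoc)
qed (auto simp: distrib_right intro: twosided_ideal.intros)

lemma twosided_ideal_uminus: "u \<in> twosided_ideal R \<Longrightarrow> - u \<in> twosided_ideal R"
  using twosided_ideal_mult_left[of u R "- 1"] by simp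

lemma twosided_ideal_diff:
  "u \<in> twosided_ideal R \<Longrightarrow> v \<in> twosided_ideal R \<Longrightarrow> u - v \<in> twosided_ideal R"
  using twosided_ideal.add[of u R "- v"] twosided_ideal_uminus by auto

definition relcong :: "falg \<Rightarrow> falg \<Rightarrow> bool"
  where "relcong x y \<longleftrightarrow> x - y \<in> twosided_ideal relators"

lemma relcong_refl: "relcong x x"
  by (simp add: relcong_def twosided_ideal.zero)

lemma equivp_relcong: "equivp relcong"
proof (rule equivpI)
  show "reflp relcong"
    by (simp add: reflp_def relcong_refl)
  show "symp relcong"
  proof (rule sympI)
    fix x y assume "relcong x y"
    then have "- (x - y) \<in> twosided_ideal relators"
      unfolding relcong_def by (rule twosided_ideal_uminus)
    then show "relcong y x"
      by (simp add: relcong_def)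
  qed
  show "transp relcong"
  proof (rule transpI)
    fix x y z assume "relcong x y" "relcong y z"
    then have "(x - y) + (y - z) \<in> twosided_ideal relators"
      unfolding relcong_def by (rule twosided_ideal.add)
    then show "relcong x z"
      by (simp add: relcong_def)
  qed
qed

quotient_type agen = falg / relcong
  by (rule equivp_relcong)

text \<open>The class \<^verbatim>\<open>ring_1\<close> is not used for \<^verbatim>\<open>agen\<close> because it includes $0 \neq 1$, which is not
  immediate for an algebra given by generators and relations.\<close>

instantiation agen :: "{ring, monoid_mult}"
begin

lift_definition zero_agen :: agen is 0 .

lift_definition one_agen :: agen is 1 .

lift_definition plus_agen :: "agen \<Rightarrow> agen \<Rightarrow> agen" is "(+)"
proof -
  fix x x' y y' :: falg
  assume "relcong x x'" and "relcong y y'"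
  then have "(x - x') + (y - y') \<in> twosided_ideal relators"
    unfolding relcong_def by (rule twosided_ideal.add)
  then show "relcong (x + y) (x' + y')"
    by (simp add: relcong_def algebra_simps)
qed

lift_definition minus_agen :: "agen \<Rightarrow> agen \<Rightarrow> agen" is "(-)"
proof -
  fix x x' y y' :: falg
  assume "relcong x x'" and "relcong y y'"
  then have "(x - x') - (y - y') \<in> twosided_ideal relators"
    unfolding relcong_def by (rule twosided_ideal_diff)
  then show "relcong (x - y) (x' - y')"
    by (simp add: relcong_def algebra_simps)
qed

lift_definition uminus_agen :: "agen \<Rightarrow> agen" is uminus
proof -
  fix x x' :: falg
  assume "relcong x x'"
  then have "- (x - x') \<in> twosided_ideal relators"
    unfolding relcong_def by (rule twosided_ideal_uminus)
  then show "relcong (- x) (- x')"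
    by (simp add: relcong_def algebra_simps)
qed

lift_definition times_agen :: "agen \<Rightarrow> agen \<Rightarrow> agen" is "(*)"
proof -
  fix x x' y y' :: falg
  assume "relcong x x'" and "relcong y y'"
  then have "(x - x') * y + x' * (y - y') \<in> twosided_ideal relators"
    unfolding relcong_def
    by (intro twosided_ideal.add twosided_ideal_mult_left twosided_ideal_mult_right)
  then show "relcong (x * y) (x' * y')"
    by (simp add: relcong_def algebra_simps)
qed

instance
proof
  fix x y z :: agen
  show "x + y + z = x + (y + z)" by transfer (simp only: add.assoc relcong_refl)
  show "x + y = y + x" by transfer (simp only: add.commute relcong_refl)
  show "0 + x = x" by transfer (simp only: add_0_left relcong_refl)
  show "- x + x = 0" by transfer (simp only: left_minus relcong_refl)
  show "x - y = x + - y" by transfer (simp only: diff_conv_add_uminus relcong_refl)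
  show "x * y * z = x * (y * z)" by transfer (simp only: mult.assoc relcong_refl)
  show "(x + y) * z = x * z + y * z" by transfer (simp only: distrib_right relcong_refl)
  show "x * (y + z) = x * y + x * z" by transfer (simp only: distrib_left relcong_refl)
  show "1 * x = x" by transfer (simp only: mult_1_left relcong_refl)
  show "x * 1 = x" by transfer (simp only: mult_1_right relcong_refl)
qed

end

lift_definition scaleP :: "cpoly \<Rightarrow> agen \<Rightarrow> agen" (infixr "*\<^sub>P" 75)
  is "\<lambda>p x. fscalar p * x"
proof -
  fix p and x x' :: falg
  assume "relcong x x'"
  then have "fscalar p * (x - x') \<in> twosided_ideal relators"
    unfolding relcong_def by (rule twosided_ideal_mult_left)
  then show "relcong (fscalar p * x) (fscalar p * x')"
    by (simp add: relcong_def right_diff_distrib)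
qed

interpretation agen: module scaleP
proof
  fix p q :: cpoly and x y :: agen
  show "p *\<^sub>P (x + y) = p *\<^sub>P x + p *\<^sub>P y"
    by transfer (simp only: distrib_left relcong_refl)
  show "(p + q) *\<^sub>P x = p *\<^sub>P x + q *\<^sub>P x"
    by transfer (simp only: fscalar_add distrib_right relcong_refl)
  show "p *\<^sub>P (q *\<^sub>P x) = (p * q) *\<^sub>P x"
    by transfer (simp only: fscalar_mult mult.assoc relcong_refl)
  show "1 *\<^sub>P x = x"
    by transfer (simp only: fscalar_1 mult_1_left relcong_refl)
qed

lemma scaleP_mult_left: "(p *\<^sub>P x) * y = p *\<^sub>P (x * y)"
  by transfer (simp only: mult.assoc relcong_refl)

lemma scaleP_mult_right: "x * (p *\<^sub>P y) = p *\<^sub>P (x * y)"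
proof transfer
  fix x y p
  have "x * (fscalar p * y) = fscalar p * (x * y)"
    by (metis fscalar_commute mult.assoc)
  then show "relcong (x * (fscalar p * y)) (fscalar p * (x * y))"
    by (simp add: relcong_def twosided_ideal.zero)
qed

lift_definition agen_gen :: "gen \<Rightarrow> agen" is fgen .

abbreviation "A \<equiv> agen_gen GA"
abbreviation "B \<equiv> agen_gen GB"
abbreviation "C \<equiv> agen_gen GC"

definition scalars :: "agen set"
  where "scalars = range (\<lambda>p. p *\<^sub>P 1)"

definition center :: "'a::semigroup_mult set"
  where "center = {z. \<forall>x. z * x = x * z}"

subsection \<open>Filtration and degree\<close>

fun gen_degree :: "gen \<Rightarrow> nat" where
  "gen_degree GA = 3"
| "gen_degree GB = 4"
| "gen_degree GC = 6"

definition filtered_piece :: "nat \<Rightarrow> agen set" where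
  "filtered_piece n =
    agen.span {prod_list (map agen_gen ws) | ws. sum_list (map gen_degree ws) \<le> n}"

definition degree :: "agen \<Rightarrow> nat"
  where "degree x = (LEAST n. x \<in> filtered_piece n)"

lemma filtered_piece_mono: "m \<le> n \<Longrightarrow> filtered_piece m \<subseteq> filtered_piece n"
  unfolding filtered_piece_def by (rule agen.span_mono) auto

text \<open>The filtration is exhaustive, so the minimum in the definition of the degree is attained.\<close>

lemma filtered_piece_exhaustive: "\<exists>n. x \<in> filtered_piece n"
proof -
  have word: "abs_agen (Poly_Mapping.single w p)
      = p *\<^sub>P prod_list (map agen_gen (letters w))" for w p
  proof -
    have *: "prod_list (map agen_gen ws) = abs_agen (Poly_Mapping.single (Word ws) 1)" for ws
    proof (induction ws)
      case Nil
      have "Poly_Mapping.single (Word []) 1 = (1 :: falg)"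
        by (metis single_one zero_word_def)
      then show ?case by (simp add: one_agen.abs_eq)
    next
      case (Cons g ws)
      have "fgen g * Poly_Mapping.single (Word ws) 1 = Poly_Mapping.single (Word (g # ws)) 1"
        by (simp add: fgen_def mult_single plus_word_def)
      then show ?case
        using Cons by (simp add: agen_gen.abs_eq times_agen.abs_eq)
    qed
    show ?thesis
      unfolding * by (simp add: scaleP.abs_eq fscalar_def mult_single)
  qed
  have "\<exists>n. abs_agen f \<in> filtered_piece n" for f
  proof (induction f rule: poly_mapping_monomial_induct)
    case zero
    have "abs_agen 0 = 0" by (simp add: zero_agen.abs_eq)
    then show ?case unfolding filtered_piece_def by (metis agen.span_zero)
  next
    case (add w p f)
    then obtain n where f: "abs_agen f \<in> filtered_piece n" ..
    have mono: "abs_agen (Poly_Mapping.single w p)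
        \<in> filtered_piece (sum_list (map gen_degree (letters w)))"
      unfolding word filtered_piece_def by (intro agen.span_scale agen.span_base) auto
    define N where "N = max n (sum_list (map gen_degree (letters w)))"
    have "abs_agen (Poly_Mapping.single w p) \<in> filtered_piece N"
      using mono filtered_piece_mono[of "sum_list (map gen_degree (letters w))" N]
      by (auto simp: N_def)
    moreover have "abs_agen f \<in> filtered_piece N"
      using f filtered_piece_mono[of n N] by (auto simp: N_def)
    ultimately have "abs_agen (Poly_Mapping.single w p) + abs_agen f \<in> filtered_piece N"
      unfolding filtered_piece_def by (rule agen.span_add)
    then show ?case by (auto simp: plus_agen.abs_eq)
  qed
  then show ?thesis
    using Quotient_abs_rep[OF Quotient_agen, of x] by metis
qed

subsection \<open>The element Omega\<close>

definition "x1 = const (1/6) * (12 * a9 + 3 * a0 * a5 * a0' + 2 * a4 * a3 - a4 * a0' * a1 - 6 * a6 * a1)"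
definition "x2 = const (1/3) * (- 6 * a8 - 3 * a4 * a2 + a0 * a4 * a0' + a0 * a6 + 6 * a5 * a1)"
definition "x3 = const (1/6) * (6 * a6 + 3 * a4 * a0' + 3 * a0 * a2 * a0' - 4 * a3 * a1 - a0' * a1^2)"
definition "x4 = const (1/3) * (- 3 * a5 + a0 * a3 + 3 * a2 * a1 + a0 * a0' * a1)"
definition "x5 = const (1/3) * (- 3 * a4 - 4 * a0 * a2 + a0^2 * a0' + 6 * a1^2)"
definition "x6 = const (1/3) * (2 * a3 - a0' * a1)"
definition "x7 = - 2 * a2 + a0 * a0'"
definition "x8 = 2 * a1"
definition "x9 = const (1/2) * a0'"
definition "x10 = const (- 2/3) * a0"

definition Omega :: agen where
  "Omega = x1 *\<^sub>P A + x2 *\<^sub>P B + x3 *\<^sub>P A^2 + x4 *\<^sub>P anticommutator A B + x5 *\<^sub>P B^2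
    + x6 *\<^sub>P A^3 + x7 *\<^sub>P (A * B * A) + x8 *\<^sub>P (B * C) - x8 *\<^sub>P (A * B^2)
    + x9 *\<^sub>P A^4 + x10 *\<^sub>P B^3 + C^2"

end

(*
  A PBW theorem makes the computation with coefficients legitimate. Multiply every parameter by a
  formal variable t. On the free module with basis A^i B^j C^k, let A act by shifting i; the operators
  B and C are then power series in t whose t^n-coefficients are determined by the lower ones: the
  relations for [A,B] and [A,C] force their values on A^(i+1) B^j C^k from those on A^i B^j C^k, and
  the relation for [B,C] forces C on B^(j+1) C^k. The remaining instances of the [B,C]-relation follow
  because its defect commutes with A, which is the Jacobi identity. Since the parameters are
  algebraically independent, scaling by t loses no information, so the A^i B^j C^k are linearly
  independent over the parameter ring.

  They also span the filtered pieces by weight 3i + 4j + 6k. Hence Omega commutes with A and B as soon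
  as the coefficients in the normal forms of the commutators vanish, and a central element of weight
  at most 11 has vanishing coefficients at all nontrivial monomials, read off from [A,z] = [B,z] = 0.
*)
theory Submission
  imports Defs "HOL-Library.Product_Plus" "HOL-Library.Countable"
    "HOL-Computational_Algebra.Formal_Power_Series"
begin

unbundle fps_syntax

section \<open>Linear endomorphisms of the free module on the PBW monomials\<close>

definition pm_ext :: "('a \<Rightarrow> 'b \<Rightarrow> 'c) \<Rightarrow> ('a \<Rightarrow>\<^sub>0 'b::zero) \<Rightarrow> 'c::comm_monoid_add"
  where "pm_ext h f = (\<Sum>w\<in>Poly_Mapping.keys f. h w (Poly_Mapping.lookup f w))"

lemma pm_ext_zero [simp]: "pm_ext h 0 = 0"
  by (simp add: pm_ext_def)

lemma pm_ext_single:
  assumes "h w 0 = 0"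
  shows "pm_ext h (Poly_Mapping.single w c) = h w c"
  using assms by (cases "c = 0") (auto simp: pm_ext_def)

lemma pm_ext_add:
  assumes "\<And>w. h w 0 = 0" and "\<And>w c d. h w (c + d) = h w c + h w d"
  shows "pm_ext h (f + g) = pm_ext h f + pm_ext h g"
  unfolding pm_ext_def by (rule setsum_keys_plus_distrib) (use assms in auto)

text \<open>Bilinearity of the convolution product reduces multiplicativity to single monomials.
  Exponents may be noncommutative, so the rule serves both the parameter scaling and the
  representation of the free algebra.\<close>

lemma pm_ext_mult:
  fixes h :: "'a::monoid_add \<Rightarrow> 'b::semiring_0 \<Rightarrow> 'c::semiring_0"
  assumes zero: "\<And>w. h w 0 = 0" and add: "\<And>w c d. h w (c + d) = h w c + h w d"
    and mult: "\<And>v w c d. h (v + w) (c * d) = h v c * h w d"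
  shows "pm_ext h (f * g) = pm_ext h f * pm_ext h g"
proof (induction f rule: poly_mapping_monomial_induct)
  case zero
  show ?case by simp
next
  case (add v c f)
  have "pm_ext h (Poly_Mapping.single v c * g) = h v c * pm_ext h g"
  proof (induction g rule: poly_mapping_monomial_induct)
    case zero
    show ?case by simp
  next
    case (add w d g)
    then show ?case
      by (simp add: distrib_left mult_single mult pm_ext_add pm_ext_single assms)
  qed
  with add show ?case
    by (simp add: distrib_right pm_ext_add pm_ext_single assms)
qed

text \<open>Under componentwise addition of exponents this free module is also a commutative
  polynomial ring in three variables. That product is not the one of \<open>agen\<close>; it only
  supplies scalars and exponent shifts as multiplication operators.\<close>

type_synonym pbw = "(nat \<times> nat \<times> nat) \<Rightarrow>\<^sub>0 cpoly"

abbreviation smul :: "cpoly \<Rightarrow> pbw \<Rightarrow> pbw"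
  where "smul r x \<equiv> Poly_Mapping.single 0 r * x"

definition unit_vec :: "nat \<Rightarrow> nat \<Rightarrow> nat \<Rightarrow> pbw"
  where "unit_vec i j k = Poly_Mapping.single (i, j, k) 1"

text \<open>A type instead of a set of functions, so that power series with endomorphism
  coefficients form a ring by the existing instances.\<close>

typedef endo = "{f :: pbw \<Rightarrow> pbw. (\<forall>x y. f (x + y) = f x + f y) \<and> (\<forall>r x. f (smul r x) = smul r (f x))}"
  morphisms app Endo
  by (rule exI[of _ "\<lambda>x. x"]) simp

setup_lifting type_definition_endo

instantiation endo :: ring_1
begin

lift_definition zero_endo :: endo is "\<lambda>_. 0" by simp
lift_definition one_endo :: endo is "\<lambda>x. x" by simp
lift_definition plus_endo :: "endo \<Rightarrow> endo \<Rightarrow> endo" is "\<lambda>f g x. f x + g x"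
  by (auto simp: algebra_simps)
lift_definition minus_endo :: "endo \<Rightarrow> endo \<Rightarrow> endo" is "\<lambda>f g x. f x - g x"
  by (auto simp: algebra_simps)
lift_definition uminus_endo :: "endo \<Rightarrow> endo" is "\<lambda>f x. - f x"
  by (auto simp: algebra_simps)
lift_definition times_endo :: "endo \<Rightarrow> endo \<Rightarrow> endo" is "\<lambda>f g x. f (g x)"
  by auto

instance
proof
  show "(0::endo) \<noteq> 1"
    by transfer (auto simp: fun_eq_iff intro!: exI[of _ 1])
qed (transfer; auto simp: algebra_simps fun_eq_iff)+

end

lemma app_add: "app T (x + y) = app T x + app T y"
  by transfer blast

lemma app_zero [simp]: "app T 0 = 0"
  using app_add[of T 0 0] by simp

lemma app_smul: "app T (smul r x) = smul r (app T x)"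
  by transfer blast

lemma app_0 [simp]: "app 0 x = 0" by transfer simp
lemma app_1 [simp]: "app 1 x = x" by transfer simp
lemma app_plus: "app (S + T) x = app S x + app T x" by transfer simp
lemma app_minus: "app (S - T) x = app S x - app T x" by transfer simp
lemma app_times: "app (S * T) x = app S (app T x)" by transfer simp

lemma app_sum: "app (\<Sum>i\<in>I. S i) x = (\<Sum>i\<in>I. app (S i) x)"
  by (induction I rule: infinite_finite_induct) (simp_all add: app_plus)

lemma single_eq_smul: "Poly_Mapping.single (i, j, k) r = smul r (unit_vec i j k)"
  by (simp add: unit_vec_def mult_single)

lemma endo_eqI:
  assumes "\<And>i j k. app S (unit_vec i j k) = app T (unit_vec i j k)"
  shows "S = T"
proof -
  have "app S x = app T x" for x
  proof (induction x rule: poly_mapping_monomial_induct)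
    case zero
    show ?case by simp
  next
    case (add w c f)
    then show ?case
      using assms by (cases w) (simp add: app_add single_eq_smul app_smul)
  qed
  then show ?thesis by (metis app_inverse ext)
qed

lemma app_Endo:
  assumes "\<And>x y. f (x + y) = f x + f y" and "\<And>r x. f (smul r x) = smul r (f x)"
  shows "app (Endo f) = f"
  using assms by (intro Endo_inverse) auto

definition mult_op :: "pbw \<Rightarrow> endo"
  where "mult_op x = Endo (\<lambda>y. x * y)"

lemma app_mult_op [simp]: "app (mult_op x) y = x * y"
  unfolding mult_op_def by (subst app_Endo) (simp_all add: distrib_left mult.left_commute)

definition basis_op :: "(nat \<Rightarrow> nat \<Rightarrow> nat \<Rightarrow> pbw) \<Rightarrow> endo"
  where "basis_op x = Endo (pm_ext (\<lambda>(i, j, k) r. smul r (x i j k)))"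

lemma app_basis_op [simp]: "app (basis_op x) (unit_vec i j k) = x i j k"
proof -
  let ?h = "\<lambda>(i, j, k) r. smul r (x i j k)"
  have add: "pm_ext ?h (y + z) = pm_ext ?h y + pm_ext ?h z" for y z
    by (rule pm_ext_add) (auto simp: single_add distrib_right)
  have "pm_ext ?h (smul r y) = smul r (pm_ext ?h y)" for r y
  proof (induction y rule: poly_mapping_monomial_induct)
    case zero
    show ?case by simp
  next
    case (add w c f)
    have "pm_ext ?h (smul r (Poly_Mapping.single w c)) = smul r (pm_ext ?h (Poly_Mapping.single w c))"
      by (cases w) (simp add: mult_single pm_ext_single flip: mult.assoc)
    with add show ?case
      by (simp only: distrib_left \<open>\<And>y z. pm_ext ?h (y + z) = pm_ext ?h y + pm_ext ?h z\<close>)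
  qed
  then have "app (basis_op x) = pm_ext ?h"
    unfolding basis_op_def by (intro app_Endo add)
  moreover have "pm_ext ?h (unit_vec i j k) = ?h (i, j, k) 1"
    unfolding unit_vec_def by (rule pm_ext_single) simp
  ultimately show ?thesis
    by (simp only: prod.case single_one mult_1_left)
qed

definition scal :: "cpoly \<Rightarrow> endo"
  where "scal r = mult_op (Poly_Mapping.single 0 r)"

lemma scal_0 [simp]: "scal 0 = 0"
  unfolding scal_def by (rule endo_eqI) (simp only: app_mult_op single_zero mult_zero_left app_0)

lemma scal_1 [simp]: "scal 1 = 1"
  unfolding scal_def by (rule endo_eqI) (simp only: app_mult_op single_one mult_1_left app_1)

lemma scal_add: "scal (p + q) = scal p + scal q"
  unfolding scal_def
  by (rule endo_eqI) (simp only: app_mult_op app_plus single_add distrib_right)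

lemma scal_mult: "scal (p * q) = scal p * scal q"
proof -
  have "Poly_Mapping.single 0 (p * q) = smul p (Poly_Mapping.single 0 q)"
    by (simp only: mult_single add_0_left)
  then show ?thesis
    unfolding scal_def
    by (intro endo_eqI) (simp only: app_mult_op app_times mult.assoc)
qed

lemma scal_commute: "T * scal p = scal p * T"
  unfolding scal_def by (rule endo_eqI) (simp only: app_mult_op app_times app_smul)

section \<open>The operators A, B, C\<close>

definition A_op :: endo
  where "A_op = mult_op (unit_vec 1 0 0)"

lemma app_A_op [simp]: "app A_op (unit_vec i j k) = unit_vec (Suc i) j k"
  by (simp add: A_op_def unit_vec_def mult_single)

text \<open>The recursion on the exponent of A is forced by
  \<open>T * A = A * T - D\<close>.\<close>

primrec twisted_base :: "endo \<Rightarrow> (nat \<Rightarrow> nat \<Rightarrow> pbw) \<Rightarrow> nat \<Rightarrow> nat \<Rightarrow> nat \<Rightarrow> pbw" where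
  "twisted_base D x 0 = x"
| "twisted_base D x (Suc i) = (\<lambda>j k. app A_op (twisted_base D x i j k) - app D (unit_vec i j k))"

text \<open>The operator $T$ with $[A, T] = D$ and prescribed values at the monomials without $A$.\<close>

definition twisted :: "endo \<Rightarrow> (nat \<Rightarrow> nat \<Rightarrow> pbw) \<Rightarrow> endo"
  where "twisted D x = basis_op (twisted_base D x)"

lemma app_twisted_0 [simp]: "app (twisted D x) (unit_vec 0 j k) = x j k"
  by (simp add: twisted_def)

lemma commutator_A_twisted: "A_op * twisted D x - twisted D x * A_op = D"
  by (rule endo_eqI) (simp add: twisted_def app_minus app_times)

text \<open>The values of the next coefficient of $C$ at $B^j C^k$, where \<^verbatim>\<open>T\<close> is the constant coefficient of
  $B$ and \<^verbatim>\<open>D\<close> collects the contributions of the lower coefficients to $CB = BC - [B, C]$.\<close>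

primrec C_base :: "endo \<Rightarrow> endo \<Rightarrow> nat \<Rightarrow> nat \<Rightarrow> pbw" where
  "C_base T D 0 = (\<lambda>k. 0)"
| "C_base T D (Suc j) = (\<lambda>k. app T (C_base T D j k) + app D (unit_vec 0 j k))"

section \<open>Coefficientwise construction of B and C as power series in t\<close>

definition param_op :: "cpoly \<Rightarrow> endo fps"
  where "param_op r = fps_const (scal r)"

lemma param_op_commute: "f * param_op r = param_op r * f"
  by (rule fps_ext) (simp add: param_op_def scal_commute)

definition A_fps :: "endo fps"
  where "A_fps = fps_const A_op"

text \<open>The factor t is left out here and supplied as \<open>fps_X\<close> in the relations.
  Thus the coefficient of order n on the right of a relation involves only coefficients of
  \<open>b\<close> of order below n.\<close>

definition rhs_AC :: "endo fps \<Rightarrow> endo fps" where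
  "rhs_AC b = param_op a0 * b^2 + param_op a1 * anticommutator A_fps b + param_op a2 * A_fps^2
    + param_op a4 * b + param_op a5 * A_fps + param_op a8"

definition rhs_BC :: "endo fps \<Rightarrow> endo fps" where
  "rhs_BC b = param_op a0' * A_fps^3 - param_op a1 * b^2 - param_op a2 * anticommutator A_fps b
    + param_op a3 * A_fps^2 - param_op a5 * b + param_op a6 * A_fps + param_op a9"

text \<open>At t = 0 the relations are those of the Heisenberg algebra: [A, B] = C with C central.
  So C starts as multiplication by the third variable z, and B as multiplication by y minus z times
  the derivative in x.\<close>

definition C0_op :: endo
  where "C0_op = mult_op (unit_vec 0 0 1)"

lemma app_C0_op [simp]: "app C0_op (unit_vec i j k) = unit_vec i j (Suc k)"
  by (simp add: C0_op_def unit_vec_def mult_single)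

definition B0_op :: endo
  where "B0_op = twisted C0_op (\<lambda>j k. unit_vec 0 (Suc j) k)"

text \<open>The bracket with A is imposed everywhere, the bracket with B only on monomials without
  A. There the products of a lower coefficient of C with a positive-order coefficient of B vanish,
  so only \<open>b * c\<close> contributes to the correction.\<close>

definition next_C :: "nat \<Rightarrow> endo fps \<Rightarrow> endo fps \<Rightarrow> endo" where
  "next_C n b c = twisted ((fps_X * rhs_AC b) $ n) (C_base B0_op ((b * c) $ n - (fps_X * rhs_BC b) $ n))"

text \<open>B and C are built together by strong recursion. The zeros from index n on matter: they
  remove the two outer summands, which contain coefficients of order n, from coefficient n of the
  product in \<open>next_C\<close>.\<close>

fun level :: "nat \<Rightarrow> endo \<times> endo" where
  "level n = (if n = 0 then (B0_op, C0_op) else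
    let c = next_C n (Abs_fps (\<lambda>i. if i < n then fst (level i) else 0))
      (Abs_fps (\<lambda>i. if i < n then snd (level i) else 0))
    in (twisted c (\<lambda>j k. 0), c))"

declare level.simps [simp del]

definition B_fps :: "endo fps"
  where "B_fps = Abs_fps (\<lambda>n. fst (level n))"

definition C_fps :: "endo fps"
  where "C_fps = Abs_fps (\<lambda>n. snd (level n))"

lemma B_fps_nth_0 [simp]: "B_fps $ 0 = B0_op" and C_fps_nth_0 [simp]: "C_fps $ 0 = C0_op"
  by (simp_all add: B_fps_def C_fps_def level.simps)

lemma B_fps_nth: "B_fps $ n = twisted (C_fps $ n) (\<lambda>j k. if n = 0 then unit_vec 0 (Suc j) k else 0)"
  by (cases "n = 0") (simp_all add: B_fps_def C_fps_def level.simps[of n] level.simps[of 0] B0_op_def Let_def)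

lemma app_B_fps_base: "app (B_fps $ n) (unit_vec 0 j k) = (if n = 0 then unit_vec 0 (Suc j) k else 0)"
  by (simp add: B_fps_nth)

lemma commutator_AB_fps: "A_fps * B_fps - B_fps * A_fps = C_fps"
  by (rule fps_ext) (simp add: A_fps_def B_fps_nth commutator_A_twisted)

definition trunc :: "nat \<Rightarrow> 'a::zero fps \<Rightarrow> 'a fps"
  where "trunc n f = Abs_fps (\<lambda>i. if i < n then f $ i else 0)"

lemma C_fps_nth: "n > 0 \<Longrightarrow> C_fps $ n = next_C n (trunc n B_fps) (trunc n C_fps)"
  by (subst C_fps_def) (simp add: level.simps[of n] Let_def trunc_def B_fps_def C_fps_def cong: if_cong)

lemma trunc_mult_nth: "m < n \<Longrightarrow> (trunc n f * trunc n g) $ m = (f * g) $ m"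
  unfolding fps_mult_nth by (rule sum.cong) (auto simp: trunc_def)

lemma trunc_nth: "m < n \<Longrightarrow> trunc n f $ m = f $ m"
  by (simp add: trunc_def)

lemma rhs_AC_trunc: "m < n \<Longrightarrow> rhs_AC (trunc n b) $ m = rhs_AC b $ m"
  by (simp add: rhs_AC_def param_op_def A_fps_def anticommutator_def power2_eq_square
      trunc_mult_nth trunc_nth)

lemma rhs_BC_trunc: "m < n \<Longrightarrow> rhs_BC (trunc n b) $ m = rhs_BC b $ m"
  by (simp add: rhs_BC_def param_op_def A_fps_def anticommutator_def power2_eq_square
      trunc_mult_nth trunc_nth)

lemma C_fps_nth_pos:
  assumes "n > 0"
  shows "C_fps $ n = twisted ((fps_X * rhs_AC B_fps) $ n)
    (C_base B0_op ((trunc n B_fps * trunc n C_fps) $ n - (fps_X * rhs_BC B_fps) $ n))"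
  using assms by (simp add: C_fps_nth next_C_def rhs_AC_trunc rhs_BC_trunc)

lemma commutator_AC_fps: "A_fps * C_fps - C_fps * A_fps = fps_X * rhs_AC B_fps"
proof (rule fps_ext)
  fix n
  show "(A_fps * C_fps - C_fps * A_fps) $ n = (fps_X * rhs_AC B_fps) $ n"
  proof (cases "n = 0")
    case True
    then show ?thesis
      by (simp add: A_fps_def) (rule endo_eqI, simp add: app_minus app_times)
  next
    case False
    then show ?thesis
      by (simp add: A_fps_def C_fps_nth_pos commutator_A_twisted del: fps_X_mult_nth)
  qed
qed

text \<open>Separates the two summands containing coefficients of order n from the lower ones; n > 0
  keeps these two distinct.\<close>

lemma mult_nth_trunc:
  fixes f g :: "'a::ring_1 fps"
  assumes "n > 0"
  shows "(f * g) $ n = f $ 0 * g $ n + (trunc n f * trunc n g) $ n + f $ n * g $ 0"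
proof -
  have "f $ i * g $ (n - i) = trunc n f $ i * trunc n g $ (n - i)
      + ((if i = 0 then f $ 0 * g $ n else 0) + (if i = n then f $ n * g $ 0 else 0))"
    if "i \<in> {0..n}" for i
    using that assms by (auto simp: trunc_def)
  then have "(f * g) $ n = (\<Sum>i=0..n. trunc n f $ i * trunc n g $ (n - i)
      + ((if i = 0 then f $ 0 * g $ n else 0) + (if i = n then f $ n * g $ 0 else 0)))"
    unfolding fps_mult_nth by (rule sum.cong[OF refl])
  also have "\<dots> = (trunc n f * trunc n g) $ n + (f $ 0 * g $ n + f $ n * g $ 0)"
    by (simp add: sum.distrib fps_mult_nth)
  finally show ?thesis by (simp add: algebra_simps)
qed

text \<open>The construction gives the relation on monomials without A. The defect \<open>D\<close>
  commutes with A, so its vanishing there propagates along powers of A. In \<open>jac\<close> no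
  relation between A and B enters: the parameters a1, a2, a5 shared by both right-hand sides make it
  a formal identity.\<close>

lemma commutator_BC_fps: "B_fps * C_fps - C_fps * B_fps = fps_X * rhs_BC B_fps"
proof -
  define D where "D = B_fps * C_fps - C_fps * B_fps - fps_X * rhs_BC B_fps"
  have BA: "B_fps * A_fps = A_fps * B_fps - C_fps" and CA: "C_fps * A_fps = A_fps * C_fps - fps_X * rhs_AC B_fps"
    using commutator_AB_fps commutator_AC_fps by (simp_all add: algebra_simps)
  have X: "f * (fps_X * g) = fps_X * (f * g)" for f g :: "endo fps"
    by (metis fps_mult_fps_X_commute mult.assoc)
  have P: "f * (param_op r * g) = param_op r * (f * g)" for f g r
    by (metis param_op_commute mult.assoc)
  \<comment> \<open>the Jacobi identity for $A$, $B$ and $C$, after replacing the outer brackets by the relations\<close>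
  have jac: "B_fps * rhs_AC B_fps - rhs_AC B_fps * B_fps = A_fps * rhs_BC B_fps - rhs_BC B_fps * A_fps"
    unfolding rhs_AC_def rhs_BC_def anticommutator_def
    by (simp add: power2_eq_square power3_eq_cube algebra_simps P param_op_commute[of A_fps] param_op_commute[of B_fps])
  have "D * A_fps = B_fps * (A_fps * C_fps - fps_X * rhs_AC B_fps) - C_fps * (A_fps * B_fps - C_fps)
      - fps_X * (rhs_BC B_fps * A_fps)"
    by (simp add: D_def left_diff_distrib mult.assoc CA BA)
  also have "\<dots> = (B_fps * A_fps) * C_fps - (C_fps * A_fps) * B_fps + C_fps * C_fps
      - fps_X * (B_fps * rhs_AC B_fps) - fps_X * (rhs_BC B_fps * A_fps)"
    by (simp add: algebra_simps X)
  also have "\<dots> = A_fps * (B_fps * C_fps - C_fps * B_fps) - fps_X * ((B_fps * rhs_AC B_fps - rhs_AC B_fps * B_fps)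
      + rhs_BC B_fps * A_fps)"
    unfolding BA CA by (simp add: algebra_simps)
  also have "\<dots> = A_fps * D"
    unfolding jac D_def by (simp add: algebra_simps X)
  finally have DA: "D * A_fps = A_fps * D" .
  have base: "app (D $ n) (unit_vec 0 j k) = 0" for n j k
  proof -
    \<comment> \<open>On monomials without A only the constant coefficient of B is nonzero, so a
      single summand survives.\<close>
    have CB: "app ((C_fps * B_fps) $ n) (unit_vec 0 j k) = app (C_fps $ n) (unit_vec 0 (Suc j) k)"
    proof -
      have "app ((C_fps * B_fps) $ n) (unit_vec 0 j k)
          = (\<Sum>i=0..n. if i = n then app (C_fps $ n) (unit_vec 0 (Suc j) k) else 0)"
        unfolding fps_mult_nth app_sum app_times
        by (rule sum.cong) (auto simp: app_B_fps_base)
      then show ?thesis by simp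
    qed
    show ?thesis
    proof (cases "n = 0")
      case True
      then show ?thesis
        by (simp add: D_def app_minus app_times B0_op_def)
    next
      case False
      let ?T = "(trunc n B_fps * trunc n C_fps) $ n" and ?G = "(fps_X * rhs_BC B_fps) $ n"
      have "app (C_fps $ n) (unit_vec 0 (Suc j) k)
          = app B0_op (app (C_fps $ n) (unit_vec 0 j k)) + app (?T - ?G) (unit_vec 0 j k)"
        using False by (simp only: C_fps_nth_pos app_twisted_0 C_base.simps)
      moreover have "app ((B_fps * C_fps) $ n) (unit_vec 0 j k)
          = app B0_op (app (C_fps $ n) (unit_vec 0 j k)) + app ?T (unit_vec 0 j k)"
        using False by (subst mult_nth_trunc) (simp_all add: app_plus app_times app_B_fps_base)
      ultimately show ?thesis
        by (simp only: D_def fps_sub_nth app_minus CB) simp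
    qed
  qed
  have "app (D $ n) (unit_vec i j k) = 0" for n i j k
  proof (induction i)
    case 0
    show ?case by (rule base)
  next
    case (Suc i)
    have "D $ n * A_op = A_op * D $ n"
      using DA by (simp add: A_fps_def fps_eq_iff)
    then have "app (D $ n) (unit_vec (Suc i) j k) = app A_op (app (D $ n) (unit_vec i j k))"
      by (metis app_times app_A_op)
    with Suc show ?case by simp
  qed
  then have "D = 0"
    by (intro fps_ext endo_eqI) simp
  then show ?thesis by (simp add: D_def)
qed

section \<open>The representation and linear independence\<close>

definition total_degree :: "(param \<Rightarrow>\<^sub>0 nat) \<Rightarrow> nat"
  where "total_degree = pm_ext (\<lambda>_ c. c)"

lemma total_degree_add: "total_degree (m + n) = total_degree m + total_degree n"
  by (simp add: total_degree_def pm_ext_add)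

lemma total_degree_0 [simp]: "total_degree 0 = 0"
  by (simp add: total_degree_def)

lemma total_degree_single [simp]: "total_degree (Poly_Mapping.single p n) = n"
  by (simp add: total_degree_def pm_ext_single)

lemma param_op_0 [simp]: "param_op 0 = 0"
  by (simp add: param_op_def)

lemma param_op_1 [simp]: "param_op 1 = 1"
  by (simp add: param_op_def)

lemma param_op_add: "param_op (p + q) = param_op p + param_op q"
  by (simp add: param_op_def scal_add)

lemma param_op_mult: "param_op (p * q) = param_op p * param_op q"
  by (simp add: param_op_def scal_mult)

text \<open>The coefficient ring is noncommutative, but the formal variable is central.\<close>

lemma fps_X_power_commute: "f * fps_X ^ n = fps_X ^ n * (f :: 'a::ring_1 fps)"
proof (induction n)
  case (Suc n)
  have "f * fps_X ^ Suc n = (f * fps_X) * fps_X ^ n"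
    by (simp add: mult.assoc)
  also have "\<dots> = fps_X * (f * fps_X ^ n)"
    by (simp only: fps_mult_fps_X_commute[of f, symmetric] mult.assoc)
  finally show ?case
    by (simp add: Suc mult.assoc)
qed simp

text \<open>The scaling $a_i \mapsto t a_i$, with \<^verbatim>\<open>fps_X\<close> as $t$.\<close>

definition param_fps :: "cpoly \<Rightarrow> endo fps"
  where "param_fps = pm_ext (\<lambda>m c. param_op (Poly_Mapping.single m c) * fps_X ^ total_degree m)"

lemma param_fps_add: "param_fps (p + q) = param_fps p + param_fps q"
  unfolding param_fps_def by (rule pm_ext_add) (simp_all add: single_add param_op_add distrib_right)

lemma param_fps_single:
  "param_fps (Poly_Mapping.single m c) = param_op (Poly_Mapping.single m c) * fps_X ^ total_degree m"
  unfolding param_fps_def by (rule pm_ext_single) simp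

lemma param_fps_0 [simp]: "param_fps 0 = 0"
  by (simp add: param_fps_def)

lemma param_fps_1 [simp]: "param_fps 1 = 1"
  using param_fps_single[of 0 1] by simp

lemma param_fps_indet: "param_fps (indet p) = fps_X * param_op (indet p)"
  unfolding indet_def param_fps_single by (simp flip: param_op_commute)

lemma param_fps_mult: "param_fps (p * q) = param_fps p * param_fps q"
  unfolding param_fps_def
proof (rule pm_ext_mult)
  fix m n :: "param \<Rightarrow>\<^sub>0 nat" and c d :: complex
  let ?c = "param_op (Poly_Mapping.single m c)" and ?d = "param_op (Poly_Mapping.single n d)"
  have "param_op (Poly_Mapping.single (m + n) (c * d)) * fps_X ^ total_degree (m + n)
      = ?c * (?d * fps_X ^ total_degree m) * fps_X ^ total_degree n"
    by (simp only: mult_single[symmetric] param_op_mult total_degree_add power_add mult.assoc)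
  also have "\<dots> = (?c * fps_X ^ total_degree m) * (?d * fps_X ^ total_degree n)"
    by (simp only: fps_X_power_commute[of ?d] mult.assoc)
  finally show "param_op (Poly_Mapping.single (m + n) (c * d)) * fps_X ^ total_degree (m + n)
      = (?c * fps_X ^ total_degree m) * (?d * fps_X ^ total_degree n)" .
qed (simp_all add: single_add param_op_add distrib_right)

lemma param_fps_commute: "f * param_fps p = param_fps p * f"
proof (induction p rule: poly_mapping_monomial_induct)
  case zero
  show ?case by simp
next
  case (add m c p)
  have "f * param_fps (Poly_Mapping.single m c) = param_fps (Poly_Mapping.single m c) * f"
    unfolding param_fps_single
    by (metis param_op_commute fps_X_power_commute mult.assoc)
  with add show ?case by (simp add: param_fps_add distrib_left distrib_right)
qed

definition homogeneous_part :: "nat \<Rightarrow> cpoly \<Rightarrow> cpoly"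
  where "homogeneous_part n = pm_ext (\<lambda>m c. if total_degree m = n then Poly_Mapping.single m c else 0)"

lemma homogeneous_part_single:
  "homogeneous_part n (Poly_Mapping.single m c) = (if total_degree m = n then Poly_Mapping.single m c else 0)"
  unfolding homogeneous_part_def by (rule pm_ext_single) simp

lemma homogeneous_part_add: "homogeneous_part n (p + q) = homogeneous_part n p + homogeneous_part n q"
  unfolding homogeneous_part_def by (rule pm_ext_add) (auto simp: single_add)

text \<open>The power of t records the total degree in the parameters, so the coefficients together
  recover \<open>p\<close>: the scaling is injective.\<close>

lemma param_fps_nth: "param_fps p $ n = scal (homogeneous_part n p)"
proof (induction p rule: poly_mapping_monomial_induct)
  case zero
  show ?case by (simp add: homogeneous_part_def)
next
  case (add m c p)
  have "param_fps (Poly_Mapping.single m c) $ n = scal (homogeneous_part n (Poly_Mapping.single m c))"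
    by (auto simp: param_fps_single param_op_def homogeneous_part_single)
  with add show ?case by (simp add: param_fps_add homogeneous_part_add scal_add)
qed

lemma lookup_homogeneous_part:
  "Poly_Mapping.lookup (homogeneous_part n p) m = (if total_degree m = n then Poly_Mapping.lookup p m else 0)"
proof (induction p rule: poly_mapping_monomial_induct)
  case zero
  show ?case by (simp add: homogeneous_part_def)
next
  case (add m c p)
  then show ?case
    by (auto simp: homogeneous_part_add homogeneous_part_single lookup_add lookup_single when_def)
qed

section \<open>Representation of the free algebra and its descent to the quotient\<close>

fun gen_fps :: "gen \<Rightarrow> endo fps" where
  "gen_fps GA = A_fps"
| "gen_fps GB = B_fps"
| "gen_fps GC = C_fps"

definition free_rep :: "falg \<Rightarrow> endo fps"
  where "free_rep = pm_ext (\<lambda>w p. param_fps p * prod_list (map gen_fps (letters w)))"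

lemma free_rep_add: "free_rep (x + y) = free_rep x + free_rep y"
  unfolding free_rep_def by (rule pm_ext_add) (simp_all add: param_fps_add distrib_right)

lemma free_rep_0 [simp]: "free_rep 0 = 0"
  by (simp add: free_rep_def)

lemma free_rep_minus: "free_rep (x - y) = free_rep x - free_rep y"
  using free_rep_add[of "x - y" y] by simp

lemma free_rep_mult: "free_rep (x * y) = free_rep x * free_rep y"
  unfolding free_rep_def
proof (rule pm_ext_mult)
  fix v w :: word and p q
  let ?v = "prod_list (map gen_fps (letters v))" and ?w = "prod_list (map gen_fps (letters w))"
  have "?v * (param_fps q * ?w) = param_fps q * (?v * ?w)"
    by (metis param_fps_commute mult.assoc)
  then show "param_fps (p * q) * prod_list (map gen_fps (letters (v + w))) = (param_fps p * ?v) * (param_fps q * ?w)"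
    by (simp add: param_fps_mult plus_word_def mult.assoc)
qed (simp_all add: param_fps_add distrib_right)

lemma free_rep_single:
  "free_rep (Poly_Mapping.single w p) = param_fps p * prod_list (map gen_fps (letters w))"
  unfolding free_rep_def by (rule pm_ext_single) simp

lemma free_rep_fscalar: "free_rep (fscalar p) = param_fps p"
  by (simp add: fscalar_def free_rep_single zero_word_def)

lemma free_rep_fgen: "free_rep (fgen g) = gen_fps g"
  by (simp add: fgen_def free_rep_single)

lemma free_rep_1: "free_rep 1 = 1"
  using free_rep_fscalar[of 1] by simp

lemma free_rep_relator:
  assumes "r \<in> relators"
  shows "free_rep r = 0"
proof -
  \<comment> \<open>Each term on the right is linear in the parameters, so the scaling produces
    exactly one factor \<open>fps_X\<close>.\<close>
  have X: "fps_X * rhs_AC B_fps =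
      free_rep (fscalar a0 * fgen GB ^ 2 + fscalar a1 * anticommutator (fgen GA) (fgen GB)
        + fscalar a2 * fgen GA ^ 2 + fscalar a4 * fgen GB + fscalar a5 * fgen GA + fscalar a8)"
    "fps_X * rhs_BC B_fps =
      free_rep (fscalar a0' * fgen GA ^ 3 - fscalar a1 * fgen GB ^ 2
        - fscalar a2 * anticommutator (fgen GA) (fgen GB)
        + fscalar a3 * fgen GA ^ 2 - fscalar a5 * fgen GB + fscalar a6 * fgen GA + fscalar a9)"
    by (simp_all only: rhs_AC_def rhs_BC_def anticommutator_def power2_eq_square power3_eq_cube free_rep_add
        free_rep_minus free_rep_mult free_rep_fscalar free_rep_fgen gen_fps.simps param_fps_indet
        distrib_left right_diff_distrib mult.assoc)
  show ?thesis
    using assms commutator_AB_fps commutator_AC_fps commutator_BC_fps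
    unfolding relators_def Let_def X
    by (auto simp: commutator_def free_rep_minus free_rep_mult free_rep_fgen simp del: gen_fps.simps)
      (auto)
qed

lemma free_rep_ideal: "u \<in> twosided_ideal relators \<Longrightarrow> free_rep u = 0"
  by (induction rule: twosided_ideal.induct)
    (simp_all add: free_rep_relator free_rep_mult free_rep_add)

lift_definition rep :: "agen \<Rightarrow> endo fps" is free_rep
proof -
  fix x y assume "relcong x y"
  then show "free_rep x = free_rep y"
    using free_rep_ideal[of "x - y"] by (simp add: relcong_def free_rep_minus)
qed

lemma rep_add: "rep (x + y) = rep x + rep y"
  by transfer (rule free_rep_add)

lemma rep_0: "rep 0 = 0"
  by transfer simp

lemma rep_1: "rep 1 = 1"
  by transfer (rule free_rep_1)

lemma rep_mult: "rep (x * y) = rep x * rep y"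
  by transfer (rule free_rep_mult)

lemma rep_scaleP: "rep (p *\<^sub>P x) = param_fps p * rep x"
  by transfer (simp add: free_rep_mult free_rep_fscalar)

lemma rep_gen: "rep (agen_gen g) = gen_fps g"
  by transfer (rule free_rep_fgen)

lemma rep_sum: "rep (sum f I) = (\<Sum>i\<in>I. rep (f i))"
  by (induction I rule: infinite_finite_induct) (simp_all add: rep_0 rep_add)

section \<open>Linear independence of the ordered monomials\<close>

definition monom :: "nat \<Rightarrow> nat \<Rightarrow> nat \<Rightarrow> agen"
  where "monom i j k = A ^ i * B ^ j * C ^ k"

text \<open>If \<open>f\<close> sends \<open>x\<close> to a vector free of t, no convolution remains
  when a further series \<open>g\<close> is applied.\<close>

lemma app_mult_nth_pure:
  assumes "\<And>n. app (f $ n) x = (if n = 0 then y else 0)"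
  shows "app ((g * f) $ n) x = app (g $ n) y"
proof -
  have "app ((g * f) $ n) x = (\<Sum>i=0..n. if i = n then app (g $ n) y else 0)"
    unfolding fps_mult_nth app_sum app_times by (rule sum.cong) (auto simp: assms)
  then show ?thesis by simp
qed

text \<open>Acting on the basis vector 1, an ordered monomial yields its own basis vector without
  higher corrections in t. For powers of C this is because \<open>C_base\<close> starts at 0, for B
  because its higher coefficients vanish on monomials without A, and the series of A is
  constant.\<close>

lemma app_rep_monom: "app (rep (monom i j k) $ n) (unit_vec 0 0 0) = (if n = 0 then unit_vec i j k else 0)"
proof -
  have C: "app ((C_fps ^ k) $ n) (unit_vec 0 0 0) = (if n = 0 then unit_vec 0 0 k else 0)" for n
  proof (induction k arbitrary: n)
    case (Suc k)
    have "app (C_fps $ n) (unit_vec 0 0 k) = (if n = 0 then unit_vec 0 0 (Suc k) else 0)"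
      by (cases "n = 0") (simp_all add: C_fps_nth_pos)
    then show ?case
      by (simp add: app_mult_nth_pure[OF Suc])
  qed (simp add: fps_one_nth)
  have B: "app ((B_fps ^ j * C_fps ^ k) $ n) (unit_vec 0 0 0) = (if n = 0 then unit_vec 0 j k else 0)" for n
  proof (induction j arbitrary: n)
    case (Suc j)
    show ?case
      by (simp only: power_Suc mult.assoc app_mult_nth_pure[OF Suc] app_B_fps_base)
  qed (simp add: C)
  have A: "app ((A_fps ^ i * (B_fps ^ j * C_fps ^ k)) $ n) (unit_vec 0 0 0) = (if n = 0 then unit_vec i j k else 0)" for n
  proof (induction i arbitrary: n)
    case (Suc i)
    show ?case
      by (simp only: power_Suc mult.assoc app_mult_nth_pure[OF Suc]) (simp add: A_fps_def)
  qed (simp add: B)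
  have pow: "rep (x ^ m) = rep x ^ m" for x m
    by (induction m) (simp_all add: rep_1 rep_mult)
  show ?thesis
    unfolding monom_def rep_mult pow rep_gen gen_fps.simps mult.assoc by (rule A)
qed

text \<open>Applying the relation to the basis vector 1 and reading off t^n places the degree-n part
  of each coefficient on its own basis vector.\<close>

lemma monom_independent:
  assumes "finite W" and "(\<Sum>(i, j, k)\<in>W. c (i, j, k) *\<^sub>P monom i j k) = 0" and "w \<in> W"
  shows "c w = 0"
proof (rule poly_mapping_eqI)
  fix m
  \<comment> \<open>The order in t at which the parameter monomial \<open>m\<close> becomes
    visible.\<close>
  let ?n = "total_degree m"
  let ?h = "\<lambda>w. homogeneous_part ?n (c w)"
  have "app (rep (case w of (i, j, k) \<Rightarrow> c (i, j, k) *\<^sub>P monom i j k) $ ?n) (unit_vec 0 0 0)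
      = Poly_Mapping.single w (?h w)" for w
    by (cases w) (simp add: rep_scaleP app_mult_nth_pure[OF app_rep_monom] param_fps_nth scal_def single_eq_smul)
  then have "0 = (\<Sum>w\<in>W. Poly_Mapping.single w (?h w))"
    using arg_cong[OF assms(2), of "\<lambda>x. app (rep x $ ?n) (unit_vec 0 0 0)"]
    by (simp only: rep_sum fps_sum_nth app_sum rep_0 fps_zero_nth app_0)
  then have "0 = Poly_Mapping.lookup (\<Sum>w\<in>W. Poly_Mapping.single w (?h w)) w"
    by (metis lookup_zero)
  also have "\<dots> = ?h w"
    using assms by (simp add: lookup_sum lookup_single when_def)
  finally have "?h w = 0" ..
  then show "Poly_Mapping.lookup (c w) m = Poly_Mapping.lookup 0 m"
    using lookup_homogeneous_part[of ?n "c w" m] by simp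
qed

section \<open>Normal forms and the filtration\<close>

lemma relator_relcong:
  assumes "x - y \<in> relators"
  shows "relcong x y"
  using twosided_ideal.gen[OF assms, of 1 1] by (simp add: relcong_def)

lemma commutator_A_B: "commutator A B = C"
  unfolding commutator_def
  by transfer (rule relator_relcong, simp add: relators_def Let_def commutator_def)

lemma commutator_A_C: "commutator A C = a0 *\<^sub>P B^2 + a1 *\<^sub>P anticommutator A B + a2 *\<^sub>P A^2
    + a4 *\<^sub>P B + a5 *\<^sub>P A + a8 *\<^sub>P 1"
  unfolding commutator_def anticommutator_def power2_eq_square
  by transfer (rule relator_relcong, simp add: relators_def Let_def commutator_def anticommutator_def power2_eq_square)

lemma commutator_B_C: "commutator B C = a0' *\<^sub>P A^3 - a1 *\<^sub>P B^2 - a2 *\<^sub>P anticommutator A B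
    + a3 *\<^sub>P A^2 - a5 *\<^sub>P B + a6 *\<^sub>P A + a9 *\<^sub>P 1"
  unfolding commutator_def anticommutator_def power2_eq_square power3_eq_cube
  by transfer (rule relator_relcong,
    simp add: relators_def Let_def commutator_def anticommutator_def power2_eq_square power3_eq_cube)

lemma A_mult_monom: "A * monom i j k = monom (Suc i) j k"
  by (simp add: monom_def mult.assoc)

lemma B_mult_monom_0: "B * monom 0 j k = monom 0 (Suc j) k"
  by (simp add: monom_def mult.assoc)

lemma C_mult_monom_0_0: "C * monom 0 0 k = monom 0 0 (Suc k)"
  by (simp add: monom_def)

lemma B_A_mult: "B * (A * x) = A * (B * x) - C * x"
  using commutator_A_B unfolding commutator_def by (metis diff_diff_eq2 add_diff_cancel_left' left_diff_distrib mult.assoc)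

lemma C_A_mult: "C * (A * x) = A * (C * x) - (a0 *\<^sub>P (B * (B * x)) + a1 *\<^sub>P (A * (B * x))
    + a1 *\<^sub>P (B * (A * x)) + a2 *\<^sub>P (A * (A * x)) + a4 *\<^sub>P (B * x) + a5 *\<^sub>P (A * x) + a8 *\<^sub>P x)"
proof -
  have "C * A = A * C - (a0 *\<^sub>P B^2 + a1 *\<^sub>P anticommutator A B + a2 *\<^sub>P A^2
    + a4 *\<^sub>P B + a5 *\<^sub>P A + a8 *\<^sub>P 1)"
    unfolding commutator_A_C[symmetric] by (simp add: commutator_def)
  then have "C * A * x = (A * C - (a0 *\<^sub>P B^2 + a1 *\<^sub>P anticommutator A B + a2 *\<^sub>P A^2
    + a4 *\<^sub>P B + a5 *\<^sub>P A + a8 *\<^sub>P 1)) * x"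
    by simp
  then show ?thesis
    by (simp add: anticommutator_def power2_eq_square distrib_right left_diff_distrib scaleP_mult_left
        agen.scale_right_distrib mult.assoc add.assoc)
qed

lemma C_B_mult: "C * (B * x) = B * (C * x) - (a0' *\<^sub>P (A * (A * (A * x))) - a1 *\<^sub>P (B * (B * x))
    - a2 *\<^sub>P (A * (B * x)) - a2 *\<^sub>P (B * (A * x)) + a3 *\<^sub>P (A * (A * x)) - a5 *\<^sub>P (B * x)
    + a6 *\<^sub>P (A * x) + a9 *\<^sub>P x)"
proof -
  have "C * B = B * C - (a0' *\<^sub>P A^3 - a1 *\<^sub>P B^2 - a2 *\<^sub>P anticommutator A B
    + a3 *\<^sub>P A^2 - a5 *\<^sub>P B + a6 *\<^sub>P A + a9 *\<^sub>P 1)"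
    unfolding commutator_B_C[symmetric] by (simp add: commutator_def)
  then have "C * B * x = (B * C - (a0' *\<^sub>P A^3 - a1 *\<^sub>P B^2 - a2 *\<^sub>P anticommutator A B
    + a3 *\<^sub>P A^2 - a5 *\<^sub>P B + a6 *\<^sub>P A + a9 *\<^sub>P 1)) * x"
    by simp
  then show ?thesis
    by (simp add: anticommutator_def power2_eq_square power3_eq_cube distrib_right left_diff_distrib scaleP_mult_left
        agen.scale_right_distrib mult.assoc diff_diff_eq)
qed

lemma B_mult_monom: "B * monom (Suc i) j k = A * (B * monom i j k) - C * monom i j k"
  unfolding A_mult_monom[symmetric] by (rule B_A_mult)

section \<open>Ordered monomials span the filtered pieces\<close>

definition monom_span :: "nat \<Rightarrow> agen set"
  where "monom_span n = agen.span {monom i j k | i j k. 3 * i + 4 * j + 6 * k \<le> n}"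

lemma monom_in_span: "3 * i + 4 * j + 6 * k \<le> n \<Longrightarrow> monom i j k \<in> monom_span n"
  unfolding monom_span_def by (intro agen.span_base) auto

lemma monom_span_mono:
  assumes "x \<in> monom_span m" and "m \<le> n"
  shows "x \<in> monom_span n"
proof -
  have "{monom i j k | i j k. 3 * i + 4 * j + 6 * k \<le> m} \<subseteq> {monom i j k | i j k. 3 * i + 4 * j + 6 * k \<le> n}"
    using assms(2) le_trans by blast
  then show ?thesis
    using assms(1) agen.span_mono unfolding monom_span_def by blast
qed

lemma monom_span_closed:
  "0 \<in> monom_span n"
  "x \<in> monom_span n \<Longrightarrow> y \<in> monom_span n \<Longrightarrow> x + y \<in> monom_span n"
  "x \<in> monom_span n \<Longrightarrow> y \<in> monom_span n \<Longrightarrow> x - y \<in> monom_span n"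
  "x \<in> monom_span n \<Longrightarrow> p *\<^sub>P x \<in> monom_span n"
  unfolding monom_span_def by (fact agen.span_zero agen.span_add agen.span_diff agen.span_scale)+

lemma mult_monom_span:
  assumes "x \<in> monom_span m"
    and "\<And>i j k. 3 * i + 4 * j + 6 * k \<le> m \<Longrightarrow> y * monom i j k \<in> monom_span n"
  shows "y * x \<in> monom_span n"
  using assms(1) unfolding monom_span_def
proof (induction rule: agen.span_induct_alt)
  case base
  show ?case using monom_span_closed(1) by (simp add: monom_span_def)
next
  case (step p x z)
  then have "y * x \<in> monom_span n"
    using assms(2) by auto
  then show ?case
    using step monom_span_closed(2,4)[of _ n] by (simp add: distrib_left scaleP_mult_right flip: monom_span_def)
qed

lemma A_mult_span: "x \<in> monom_span m \<Longrightarrow> m + 3 \<le> n \<Longrightarrow> A * x \<in> monom_span n"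
  by (erule mult_monom_span) (auto simp: A_mult_monom intro: monom_in_span)

text \<open>B and C are treated together, since moving B past A creates C and moving C past A or B
  creates B. Induction on the target weight works because the relations lower the weight: 6 against
  7 for [A, B], at most 8 against 9 for [A, C], at most 9 against 10 for [B, C].\<close>

lemma B_C_mult_span:
  shows "\<forall>m x. m + 4 \<le> n \<longrightarrow> x \<in> monom_span m \<longrightarrow> B * x \<in> monom_span n"
    and "\<forall>m x. m + 6 \<le> n \<longrightarrow> x \<in> monom_span m \<longrightarrow> C * x \<in> monom_span n"
proof (induction n rule: less_induct)
  case (less n)
  have lessB: "B * x \<in> monom_span n'" if "x \<in> monom_span m" "m + 4 \<le> n'" "n' < n" for m n' x
    using less(1) that by blast
  have lessC: "C * x \<in> monom_span n'" if "x \<in> monom_span m" "m + 6 \<le> n'" "n' < n" for m n' x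
    using less(2) that by blast
  \<comment> \<open>Settled before C at the same \<open>n\<close>, because moving C past B leaves
    the term \<open>B * (C * x)\<close>, which reaches full weight.\<close>
  have B: "B * x \<in> monom_span n" if "m + 4 \<le> n" "x \<in> monom_span m" for m x
  proof (rule mult_monom_span[OF that(2)])
    fix i j k :: nat
    assume *: "3 * i + 4 * j + 6 * k \<le> m"
    show "B * monom i j k \<in> monom_span n"
    proof (cases i)
      case 0
      with * that show ?thesis by (simp add: B_mult_monom_0 monom_in_span)
    next
      case (Suc i')
      let ?d = "3 * i' + 4 * j + 6 * k"
      have m: "monom i' j k \<in> monom_span ?d" by (rule monom_in_span) simp
      have "A * (B * monom i' j k) \<in> monom_span n"
        using * that Suc by (intro A_mult_span[OF lessB[OF m order_refl]]) auto
      moreover have "C * monom i' j k \<in> monom_span n"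
        using * that Suc by (intro monom_span_mono[OF lessC[OF m order_refl]]) auto
      ultimately show ?thesis
        unfolding Suc B_mult_monom by (rule monom_span_closed)
    qed
  qed
  have C: "C * x \<in> monom_span n" if "m + 6 \<le> n" "x \<in> monom_span m" for m x
  proof (rule mult_monom_span[OF that(2)])
    fix i j k :: nat
    assume *: "3 * i + 4 * j + 6 * k \<le> m"
    consider i' where "i = Suc i'" | j' where "i = 0" "j = Suc j'" | "i = 0" "j = 0"
      by (metis not0_implies_Suc)
    then show "C * monom i j k \<in> monom_span n"
    proof cases
      case 1
      let ?d = "3 * i' + 4 * j + 6 * k" and ?m = "monom i' j k"
      have d: "?d + 9 \<le> n" using * that 1 by simp
      have m: "?m \<in> monom_span ?d" by (rule monom_in_span) simp
      have Bm: "B * ?m \<in> monom_span (?d + 4)" using d by (intro lessB[OF m]) auto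
      have Cm: "C * ?m \<in> monom_span (?d + 6)" using d by (intro lessC[OF m]) auto
      have Am: "A * ?m \<in> monom_span (?d + 3)" using d by (intro A_mult_span[OF m]) auto
      show ?thesis
        unfolding 1 A_mult_monom[symmetric] C_A_mult
        using d by (intro monom_span_closed A_mult_span[OF Cm] A_mult_span[OF Bm] A_mult_span[OF Am]
            B[OF _ Bm] B[OF _ Am] monom_span_mono[OF Bm] monom_span_mono[OF Am] monom_span_mono[OF m]) auto
    next
      case 2
      let ?d = "4 * j' + 6 * k" and ?m = "monom 0 j' k"
      have d: "?d + 10 \<le> n" using * that 2 by simp
      have m: "?m \<in> monom_span ?d" by (rule monom_in_span) simp
      have Bm: "B * ?m \<in> monom_span (?d + 4)" using d by (intro lessB[OF m]) auto
      have Cm: "C * ?m \<in> monom_span (?d + 6)" using d by (intro lessC[OF m]) auto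
      have Am: "A * ?m \<in> monom_span (?d + 3)" using d by (intro A_mult_span[OF m]) auto
      have AAm: "A * (A * ?m) \<in> monom_span (?d + 6)" using d by (intro A_mult_span[OF Am]) auto
      show ?thesis
        unfolding 2 B_mult_monom_0[symmetric] C_B_mult
        using d by (intro monom_span_closed A_mult_span[OF AAm] A_mult_span[OF Bm] A_mult_span[OF Am]
            B[OF _ Cm] B[OF _ Bm] B[OF _ Am] monom_span_mono[OF Bm] monom_span_mono[OF Am]
            monom_span_mono[OF AAm] monom_span_mono[OF m]) auto
    next
      case 3
      with * that show ?thesis by (simp add: C_mult_monom_0_0 monom_in_span)
    qed
  qed
  show "\<forall>m x. m + 4 \<le> n \<longrightarrow> x \<in> monom_span m \<longrightarrow> B * x \<in> monom_span n"
    and "\<forall>m x. m + 6 \<le> n \<longrightarrow> x \<in> monom_span m \<longrightarrow> C * x \<in> monom_span n"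
    using B C by blast+
qed

lemma B_mult_span: "x \<in> monom_span m \<Longrightarrow> m + 4 \<le> n \<Longrightarrow> B * x \<in> monom_span n"
  and C_mult_span: "x \<in> monom_span m \<Longrightarrow> m + 6 \<le> n \<Longrightarrow> C * x \<in> monom_span n"
  using B_C_mult_span by blast+

lemma monom_0: "monom 0 0 0 = 1"
  by (simp add: monom_def)

lemma filtered_piece_subset_monom_span: "filtered_piece n \<subseteq> monom_span n"
proof -
  have word: "prod_list (map agen_gen ws) \<in> monom_span (sum_list (map gen_degree ws))" for ws
  proof (induction ws)
    case Nil
    show ?case using monom_in_span[of 0 0 0 0] by (simp add: monom_0)
  next
    case (Cons g ws)
    then show ?case
      using A_mult_span[OF Cons] B_mult_span[OF Cons] C_mult_span[OF Cons] by (cases g) auto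
  qed
  show ?thesis
    unfolding filtered_piece_def
  proof (rule agen.span_minimal)
    show "{prod_list (map agen_gen ws) | ws. sum_list (map gen_degree ws) \<le> n} \<subseteq> monom_span n"
      using monom_span_mono[OF word] by blast
    show "agen.subspace (monom_span n)"
      unfolding monom_span_def by (rule agen.subspace_span)
  qed
qed

section \<open>Linear combinations given by coefficient functions\<close>

definition comb :: "(nat \<times> nat \<times> nat) set \<Rightarrow> (nat \<times> nat \<times> nat \<Rightarrow> cpoly) \<Rightarrow> agen"
  where "comb W c = (\<Sum>(i, j, k)\<in>W. c (i, j, k) *\<^sub>P monom i j k)"

lemma comb_add: "comb W c + comb W d = comb W (\<lambda>w. c w + d w)"
  by (simp add: comb_def sum.distrib case_prod_unfold agen.scale_left_distrib)

lemma comb_minus: "comb W c - comb W d = comb W (\<lambda>w. c w - d w)"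
  by (simp add: comb_def sum_subtractf case_prod_unfold agen.scale_left_diff_distrib)

lemma comb_eq_0: "(\<And>w. w \<in> W \<Longrightarrow> c w = 0) \<Longrightarrow> comb W c = 0"
  by (auto simp: comb_def intro!: sum.neutral)

lemma comb_scale: "p *\<^sub>P comb W c = comb W (\<lambda>w. p * c w)"
  by (simp add: comb_def agen.scale_sum_right case_prod_unfold)

lemma scaleP_monom_eq_comb:
  assumes "finite W" "(i, j, k) \<in> W"
  shows "p *\<^sub>P monom i j k = comb W (\<lambda>w. if w = (i, j, k) then p else 0)"
proof -
  have "comb W (\<lambda>w. if w = (i, j, k) then p else 0) = (\<Sum>w\<in>W. if w = (i, j, k) then p *\<^sub>P monom i j k else 0)"
    unfolding comb_def by (rule sum.cong) (auto split: if_splits)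
  then show ?thesis using assms by simp
qed

lemma comb_eq_0D: "comb W c = 0 \<Longrightarrow> finite W \<Longrightarrow> w \<in> W \<Longrightarrow> c w = 0"
  unfolding comb_def by (rule monom_independent)

lemma monom_spanE:
  assumes "x \<in> monom_span n"
  obtains c where "x = comb {(i, j, k). 3 * i + 4 * j + 6 * k \<le> n} c"
proof -
  let ?W = "{(i, j, k). 3 * i + 4 * j + 6 * k \<le> n}"
  have "?W \<subseteq> {..n} \<times> {..n} \<times> {..n}" by auto
  then have fin: "finite ?W" by (rule finite_subset) auto
  have "\<exists>c. x = comb ?W c"
    using assms unfolding monom_span_def
  proof (induction rule: agen.span_induct_alt)
    case base
    have "0 = comb ?W (\<lambda>_. 0)" by (rule comb_eq_0[symmetric]) simp
    then show ?case by blast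
  next
    case (step p x y)
    then obtain i j k c where "x = monom i j k" "(i, j, k) \<in> ?W" "y = comb ?W c"
      by auto
    then have "p *\<^sub>P x + y = comb ?W (\<lambda>w. (if w = (i, j, k) then p else 0) + c w)"
      by (simp only: scaleP_monom_eq_comb[OF fin] comb_add)
    then show ?case by blast
  qed
  with that show ?thesis by blast
qed

section \<open>Central elements\<close>

instance param :: countable
  by countable_datatype

text \<open>An arbitrary linear order on the indeterminates, which makes \<^typ>\<open>cpoly\<close> an integral domain.\<close>

instantiation param :: linorder
begin

definition less_eq_param :: "param \<Rightarrow> param \<Rightarrow> bool"
  where "(p :: param) \<le> q \<longleftrightarrow> to_nat p \<le> to_nat q"

definition less_param :: "param \<Rightarrow> param \<Rightarrow> bool"
  where "(p :: param) < q \<longleftrightarrow> to_nat p < to_nat q"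

instance
  by standard (auto simp: less_eq_param_def less_param_def)

end

lemma C_mult_monom_Suc: "C * monom (Suc i) j k = A * (C * monom i j k) -
    (a0 *\<^sub>P (B * (B * monom i j k)) + a1 *\<^sub>P (A * (B * monom i j k))
    + a1 *\<^sub>P (B * (A * monom i j k)) + a2 *\<^sub>P (A * (A * monom i j k)) + a4 *\<^sub>P (B * monom i j k)
    + a5 *\<^sub>P (A * monom i j k) + a8 *\<^sub>P monom i j k)"
  unfolding A_mult_monom[of i, symmetric] by (rule C_A_mult)

lemma C_mult_monom_0_Suc: "C * monom 0 (Suc j) k = B * (C * monom 0 j k) -
    (a0' *\<^sub>P (A * (A * (A * monom 0 j k))) - a1 *\<^sub>P (B * (B * monom 0 j k))
    - a2 *\<^sub>P (A * (B * monom 0 j k)) - a2 *\<^sub>P (B * (A * monom 0 j k)) + a3 *\<^sub>P (A * (A * monom 0 j k))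
    - a5 *\<^sub>P (B * monom 0 j k) + a6 *\<^sub>P (A * monom 0 j k) + a9 *\<^sub>P monom 0 j k)"
  unfolding B_mult_monom_0[of j, symmetric] by (rule C_B_mult)

lemmas monom_mult = A_mult_monom B_mult_monom_0 B_mult_monom C_mult_monom_0_0 C_mult_monom_0_Suc
  C_mult_monom_Suc

lemma commutator_add: "commutator x (y + z) = commutator x y + commutator x z"
  for x y z :: "'a::ring"
  by (simp add: commutator_def algebra_simps)

lemma commutator_diff: "commutator x (y - z) = commutator x y - commutator x z"
  for x y z :: "'a::ring"
  by (simp add: commutator_def algebra_simps)

lemma commutator_mult: "commutator x (y * z) = commutator x y * z + y * commutator x z"
  for x y z :: "'a::ring"
  by (simp add: commutator_def algebra_simps)

lemma commutator_self: "commutator x x = 0"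
  for x :: "'a::ring"
  by (simp add: commutator_def)

lemma commutator_scaleP: "commutator x (p *\<^sub>P y) = p *\<^sub>P commutator x y"
  by (simp add: commutator_def scaleP_mult_left scaleP_mult_right agen.scale_right_diff_distrib)

lemma commutator_B_A: "commutator B A = (-1) *\<^sub>P C"
  using commutator_A_B unfolding commutator_def by (simp add: agen.scale_minus_left) (metis minus_diff_eq)

text \<open>All monomials occurring in $\Omega$, in its brackets with $A$ and $B$, and in the brackets of elements
  of weight at most 11 with $A$ and $B$.\<close>

definition low_exponents :: "(nat \<times> nat \<times> nat) set" where
  "low_exponents = {(0,0,0), (1,0,0), (0,1,0), (2,0,0), (0,0,1), (1,1,0), (0,2,0), (3,0,0), (1,0,1),
    (2,1,0), (0,1,1), (1,2,0), (4,0,0), (0,3,0), (0,0,2), (2,0,1), (3,1,0), (1,1,1), (2,2,0), (0,2,1), (3,0,1)}"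

lemma finite_low_exponents: "finite low_exponents"
  by (simp add: low_exponents_def)

text \<open>Normalisation by \<open>monom_mult\<close> yields exponents built from
  \<open>Suc\<close>; in this form membership and equality of triples are decided by
  constructors.\<close>

lemmas low_exponents_Suc = low_exponents_def[unfolded eval_nat_numeral BitM.simps One_nat_def]

lemmas mem_low_exponents = arg_cong[OF low_exponents_Suc, of "\<lambda>W. w \<in> W" for w]

lemma monom_eq_comb:
  "(i, j, k) \<in> low_exponents \<Longrightarrow> monom i j k = comb low_exponents (\<lambda>w. if w = (i, j, k) then 1 else 0)"
  using scaleP_monom_eq_comb[OF finite_low_exponents, of i j k 1] by simp

text \<open>All fractions in Omega are integer multiples of one element s with 6 s = 1, so the
  coefficient identities become polynomial identities modulo this single equation.\<close>

lemma const_sixths: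
  "6 * const (1/6) = 1" "const (1/3) = 2 * const (1/6)" "const (1/2) = 3 * const (1/6)"
  "const (- 2/3) = - 4 * const (1/6)"
proof -
  have num: "numeral n * const c = const (numeral n * c)" for n c
    by (simp add: const_def mult_single flip: single_numeral)
  have neg: "- const c = const (- c)" for c
    by (simp add: const_def single_uminus)
  show "6 * const (1/6) = 1" by (simp add: num) (simp add: const_def)
  show "const (1/3) = 2 * const (1/6)" "const (1/2) = 3 * const (1/6)" "const (- 2/3) = - 4 * const (1/6)"
    by (simp_all add: num neg)
qed

lemmas x_defs = x1_def x2_def x3_def x4_def x5_def x6_def x7_def x8_def x9_def x10_def

lemmas commutator_simps = commutator_add commutator_diff commutator_mult commutator_self commutator_scaleP
  commutator_A_B commutator_A_C commutator_B_A commutator_B_C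

lemmas left_action_simps = distrib_left distrib_right left_diff_distrib right_diff_distrib
  scaleP_mult_left scaleP_mult_right mult.assoc monom_mult mult_zero_left mult_zero_right mult_1_left
  add_0_left add_0_right agen.scale_zero_right anticommutator_def power2_eq_square power3_eq_cube power4_eq_xxxx

lemmas comb_simps = monom_eq_comb mem_low_exponents insert_iff prod.inject nat.inject nat.distinct
  comb_scale comb_add comb_minus simp_thms

text \<open>The factor \<^verbatim>\<open>monom 0 0 0\<close> is 1. It turns every word into an iterated left action on a monomial, which
  \<^verbatim>\<open>monom_mult\<close> brings into normal form.\<close>

lemma commutator_A_Omega: "commutator A Omega = 0"
proof -
  have "commutator A Omega * monom 0 0 0 = 0"
    unfolding Omega_def
    apply (simp only: commutator_simps left_action_simps)
    apply (simp only: comb_simps)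
    apply (rule comb_eq_0)
    \<comment> \<open>From here there is one identity in the parameter ring for each
      exponent.\<close>
    apply (simp only: mem_low_exponents insert_iff empty_iff)
    apply (elim disjE)
    apply (simp_all)
    apply (simp_all only: x_defs const_sixths)
    apply ((insert const_sixths(1), algebra)+)
    done
  then show ?thesis by (simp add: monom_0)
qed

lemma commutator_B_Omega: "commutator B Omega = 0"
proof -
  have "commutator B Omega * monom 0 0 0 = 0"
    unfolding Omega_def
    apply (simp only: commutator_simps left_action_simps)
    apply (simp only: comb_simps)
    apply (rule comb_eq_0)
    apply (simp only: mem_low_exponents insert_iff empty_iff)
    apply (elim disjE)
    apply (simp_all)
    apply (simp_all only: x_defs const_sixths)
    apply ((insert const_sixths(1), algebra)+)
    done
  then show ?thesis by (simp add: monom_0)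
qed

section \<open>Central elements of weight at most 11 are scalars\<close>

lemma comb_eq_0_iff: "finite W \<Longrightarrow> comb W c = 0 \<longleftrightarrow> (\<forall>w\<in>W. c w = 0)"
  using comb_eq_0D comb_eq_0 by blast

lemma commutator_1: "commutator x (1 :: agen) = 0"
  by (simp add: commutator_def)

lemma exponents_11: "{(i, j, k). 3 * i + 4 * j + 6 * k \<le> (11::nat)} =
  {(0,0,0), (1,0,0), (0,1,0), (2,0,0), (0,0,1), (1,1,0), (0,2,0), (3,0,0), (1,0,1), (2,1,0), (0,1,1), (1,2,0)}"
  (is "?L = ?R")
proof
  show "?L \<subseteq> ?R"
  proof
    fix w :: "nat \<times> nat \<times> nat"
    assume "w \<in> ?L"
    then obtain i j k where w: "w = (i, j, k)" and *: "3 * i + 4 * j + 6 * k \<le> 11"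
      by auto
    then have i: "i \<in> {0, 1, 2, 3}" and j: "j \<in> {0, 1, 2}" and k: "k \<in> {0, 1}" by auto
    have "\<forall>i\<in>{0, 1, 2, 3}. \<forall>j\<in>{0, 1, 2}. \<forall>k\<in>{0, 1}. 3 * i + 4 * j + 6 * k \<le> 11 \<longrightarrow> (i, j, k) \<in> ?R"
      by simp
    from this[rule_format, OF i j k *] show "w \<in> ?R"
      unfolding w .
  qed
  show "?R \<subseteq> ?L" by auto
qed

text \<open>Serves the coefficient of C in a central element: all coefficients of [A, C] and [B, C]
  are multiples of parameters, so a parameter has to be cancelled.\<close>

lemma indet_neq_0: "indet p \<noteq> 0"
proof
  assume "indet p = 0"
  then have "Poly_Mapping.lookup (indet p) (Poly_Mapping.single p 1) = 0" by simp
  then show False by (simp add: indet_def)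
qed

lemma central_filtered_piece_11:
  assumes "z \<in> center" "z \<in> filtered_piece 11"
  shows "z \<in> scalars"
proof -
  have "z \<in> monom_span 11"
    using assms(2) filtered_piece_subset_monom_span by blast
  then obtain c where "z = comb {(i, j, k). 3 * i + 4 * j + 6 * k \<le> 11} c"
    by (rule monom_spanE)
  then have z: "z = c (0,0,0) *\<^sub>P 1 + c (1,0,0) *\<^sub>P A + c (0,1,0) *\<^sub>P B + c (2,0,0) *\<^sub>P A^2
      + c (0,0,1) *\<^sub>P C + c (1,1,0) *\<^sub>P (A * B) + c (0,2,0) *\<^sub>P B^2 + c (3,0,0) *\<^sub>P A^3
      + c (1,0,1) *\<^sub>P (A * C) + c (2,1,0) *\<^sub>P (A^2 * B) + c (0,1,1) *\<^sub>P (B * C) + c (1,2,0) *\<^sub>P (A * B^2)"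
    unfolding exponents_11 by (simp add: comb_def monom_def add.assoc)
  have "commutator A z = 0" "commutator B z = 0"
    using assms(1) by (auto simp: center_def commutator_def)
  then have "commutator A z * monom 0 0 0 = 0" "commutator B z * monom 0 0 0 = 0"
    by simp_all
  then have "c (1,0,0) = 0 \<and> c (0,1,0) = 0 \<and> c (2,0,0) = 0 \<and> c (0,0,1) = 0 \<and> c (1,1,0) = 0 \<and> c (0,2,0) = 0
      \<and> c (3,0,0) = 0 \<and> c (1,0,1) = 0 \<and> c (2,1,0) = 0 \<and> c (0,1,1) = 0 \<and> c (1,2,0) = 0"
    unfolding z
    apply (simp only: commutator_simps commutator_1 left_action_simps)
    apply (simp only: comb_simps)
    \<comment> \<open>Linear independence turns both brackets into equations between
      coefficients.\<close>
    apply (simp only: comb_eq_0_iff[OF finite_low_exponents])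
    apply (simp only: low_exponents_Suc ball_simps)
    apply simp
    apply (elim conjE)
    apply (simp add: indet_neq_0)
    done
  then have "z = c (0,0,0) *\<^sub>P 1"
    using z by simp
  then show ?thesis by (auto simp: scalars_def)
qed

lemma Omega_notin_scalars: "Omega \<notin> scalars"
proof
  assume "Omega \<in> scalars"
  then obtain p where "Omega = p *\<^sub>P 1" by (auto simp: scalars_def)
  then have "Omega * monom 0 0 0 - p *\<^sub>P monom 0 0 0 = 0"
    by (simp add: monom_0)
  then show False
    unfolding Omega_def
    apply (simp only: left_action_simps)
    apply (simp only: comb_simps)
    \<comment> \<open>The exponent of C^2, whose coefficient in the normal form of Omega is
      1.\<close>
    apply (drule comb_eq_0D[OF _ finite_low_exponents, of _ "(0, 0, 2)"])
    apply (simp_all add: low_exponents_def)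
    done
qed

lemma word_in_filtered_piece:
  "sum_list (map gen_degree ws) \<le> n \<Longrightarrow> prod_list (map agen_gen ws) \<in> filtered_piece n"
  unfolding filtered_piece_def by (intro agen.span_base) auto

lemma Omega_in_filtered_piece: "Omega \<in> filtered_piece 12"
proof -
  note closed = agen.span_add agen.span_diff agen.span_scale
  have "A \<in> filtered_piece 12" "B \<in> filtered_piece 12" "A * A \<in> filtered_piece 12"
    "A * B \<in> filtered_piece 12" "B * A \<in> filtered_piece 12" "B * B \<in> filtered_piece 12"
    "A * (A * A) \<in> filtered_piece 12" "A * (B * A) \<in> filtered_piece 12" "B * C \<in> filtered_piece 12"
    "A * (B * B) \<in> filtered_piece 12" "A * (A * (A * A)) \<in> filtered_piece 12" "B * (B * B) \<in> filtered_piece 12"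
    "C * C \<in> filtered_piece 12"
    using word_in_filtered_piece[of "[GA]" 12] word_in_filtered_piece[of "[GB]" 12]
      word_in_filtered_piece[of "[GA, GA]" 12] word_in_filtered_piece[of "[GA, GB]" 12]
      word_in_filtered_piece[of "[GB, GA]" 12] word_in_filtered_piece[of "[GB, GB]" 12]
      word_in_filtered_piece[of "[GA, GA, GA]" 12] word_in_filtered_piece[of "[GA, GB, GA]" 12]
      word_in_filtered_piece[of "[GB, GC]" 12] word_in_filtered_piece[of "[GA, GB, GB]" 12]
      word_in_filtered_piece[of "[GA, GA, GA, GA]" 12] word_in_filtered_piece[of "[GB, GB, GB]" 12]
      word_in_filtered_piece[of "[GC, GC]" 12]
    by simp_all
  then show ?thesis
    unfolding Omega_def anticommutator_def power2_eq_square power3_eq_cube power4_eq_xxxx mult.assoc filtered_piece_def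
    by (intro closed)
qed

text \<open>Since C = [A, B], commuting with A and B gives commuting with all generators, hence with
  all words, and these span.\<close>

lemma center_eqI:
  assumes "commutator A z = 0" "commutator B z = 0"
  shows "z \<in> center"
proof -
  have AB: "z * A = A * z" "z * B = B * z"
    using assms by (simp_all add: commutator_def)
  have "z * (A * B) = A * (B * z)" "z * (B * A) = B * (A * z)"
    using AB by (metis mult.assoc)+
  then have C: "z * C = C * z"
    unfolding commutator_A_B[symmetric] commutator_def
    by (simp add: left_diff_distrib right_diff_distrib mult.assoc)
  have gen: "z * agen_gen g = agen_gen g * z" for g
    using AB C by (cases g) auto
  have word: "z * prod_list (map agen_gen ws) = prod_list (map agen_gen ws) * z" for ws
  proof (induction ws)
    case (Cons g ws)
    have "z * (agen_gen g * prod_list (map agen_gen ws)) = agen_gen g * (z * prod_list (map agen_gen ws))"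
      using gen by (metis mult.assoc)
    with Cons show ?case by (simp add: mult.assoc)
  qed simp
  have "z * x = x * z" for x
  proof -
    obtain n where "x \<in> filtered_piece n" using filtered_piece_exhaustive by blast
    then show ?thesis
      unfolding filtered_piece_def
    proof (induction rule: agen.span_induct_alt)
      case base
      show ?case by simp
    next
      case (step p x y)
      then show ?case
        using word by (auto simp: distrib_left distrib_right scaleP_mult_left scaleP_mult_right)
    qed
  qed
  then show ?thesis by (auto simp: center_def)
qed

theorem mainTheorem2:
  shows "Omega \<in> center
    \<and> degree Omega = 12
    \<and> Omega \<notin> scalars
    \<and> (\<forall>z \<in> center. z \<notin> scalars \<longrightarrow> 12 \<le> degree z)"
proof -
  have center: "Omega \<in> center"
    by (rule center_eqI[OF commutator_A_Omega commutator_B_Omega])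
  have low: "n \<ge> 12" if "z \<in> center" "z \<notin> scalars" "z \<in> filtered_piece n" for z n
  proof (rule ccontr)
    assume "\<not> n \<ge> 12"
    then have "z \<in> filtered_piece 11"
      using that(3) filtered_piece_mono[of n 11] by auto
    with that(1,2) show False using central_filtered_piece_11 by blast
  qed
  have "degree Omega = 12"
    unfolding degree_def
    by (rule Least_equality) (use Omega_in_filtered_piece low center Omega_notin_scalars in auto)
  \<comment> \<open>Exhaustiveness of the filtration ensures that the least index is attained, so
    that \<open>low\<close> applies to it.\<close>
  moreover have "12 \<le> degree z" if "z \<in> center" "z \<notin> scalars" for z
    unfolding degree_def using low[OF that] LeastI_ex[OF filtered_piece_exhaustive] by blast
  ultimately show ?thesis
    using center Omega_notin_scalars by blast
qed

end
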